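(* Let $p>3$ be a prime, let $a\in\mathbb Z_p$ with $a\not\equiv 0\pmod p$. Then $$\sum_{k=0}^{p-1}\binom ak(-2)^k\equiv (-1)^{\langle a\rangle_p}-(a-\langle a\rangle_p)E_{p-2}(-a)\pmod{p^2}.$$
   Context: $\mathbb Z_p$ denotes the set of rational numbers whose denominator is not divisible by $p$. For $x,y\in\mathbb Q$, $x\equiv y\pmod{p^m}$ means $(x-y)/p^m\in\mathbb Z_p$. For $a\in\mathbb Z_p$, $\langle a\rangle_p\in\{0,1,\ldots,p-1\}$ is defined by $a\equiv\langle a\rangle_p\pmod p$. For rational $a$ and integer $k\ge0$, $\binom ak=a(a-1)\cdots(a-k+1)/k!$. The Euler numbers are defined by $E_0=1$, $E_n=-\sum_{k=1}^{[n/2]}\binom n{2k}E_{n-2k}$ for $n\ge1$, and the Euler polynomials by $E_n(x)=\frac1{2^n}\sum_{k=0}^n\binom nk(2x-1)^{n-k}E_k$. *)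

theory Defs
  imports Complex_Main "HOL-Number_Theory.Number_Theory"
begin

(* quotient_of returns the fraction in lowest terms with positive denominator. *)
definition p_integers :: "nat \<Rightarrow> rat set" where
  "p_integers p = {x. \<not> int p dvd snd (quotient_of x)}"

definition p_cong :: "nat \<Rightarrow> nat \<Rightarrow> rat \<Rightarrow> rat \<Rightarrow> bool" where
  "p_cong p m x y \<longleftrightarrow> (x - y) / of_nat (p ^ m) \<in> p_integers p"

(* Only meaningful for prime p and a p-integral; see p_residue_unique below. *)
definition p_residue :: "nat \<Rightarrow> rat \<Rightarrow> nat" where
  "p_residue p a = (THE r. r \<in> {0..p - 1} \<and> p_cong p 1 a (of_nat r))"

fun euler_number :: "nat \<Rightarrow> rat" where
  "euler_number n = (if n = 0 then 1
     else - (\<Sum>k = 1..n div 2. of_nat (n choose (2 * k)) * euler_number (n - 2 * k)))"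

(* The defining equation would loop as a rewrite rule. *)
declare euler_number.simps [simp del]

definition euler_polynomial :: "nat \<Rightarrow> rat \<Rightarrow> rat" where
  "euler_polynomial n x =
     1 / 2 ^ n * (\<Sum>k = 0..n. of_nat (n choose k) * (2 * x - 1) ^ (n - k) * euler_number k)"

lemma p_integers_iff:
  assumes "prime p"
  shows "x \<in> p_integers p \<longleftrightarrow> (\<exists>u v :: int. \<not> int p dvd v \<and> x = of_int u / of_int v)"
proof
  assume "x \<in> p_integers p"
  then show "\<exists>u v :: int. \<not> int p dvd v \<and> x = of_int u / of_int v"
    unfolding p_integers_def by (metis (no_types, lifting) mem_Collect_eq prod.collapse quotient_of_div)
next
  assume "\<exists>u v :: int. \<not> int p dvd v \<and> x = of_int u / of_int v"
  then obtain u v :: int where uv: "\<not> int p dvd v" "x = of_int u / of_int v" by blast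
  obtain c d where q: "quotient_of x = (c, d)" by fastforce
  have d: "d > 0" "coprime c d" "x = of_int c / of_int d"
    using q quotient_of_denom_pos quotient_of_coprime quotient_of_div by blast+
  have "v \<noteq> 0" using uv(1) by auto
  then have "(of_int (c * v) :: rat) = of_int (u * d)"
    using d(1,3) uv(2) by (simp add: field_simps)
  then have "c * v = u * d" by (simp only: of_int_eq_iff)
  then have "d dvd c * v" by simp
  then have "d dvd v" using d(2) by (simp add: coprime_commute coprime_dvd_mult_right_iff)
  then show "x \<in> p_integers p"
    using uv(1) q unfolding p_integers_def by (auto intro: dvd_trans)
qed

lemma p_residue_unique:
  assumes p: "prime p" and a: "a \<in> p_integers p"
  shows "\<exists>!r. r \<in> {0..p - 1} \<and> p_cong p 1 a (of_nat r)"
proof -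
  have p0: "p > 0" using p by (rule prime_gt_0_nat)
  obtain u v :: int where uv: "\<not> int p dvd v" "a = of_int u / of_int v"
    using a p_integers_iff[OF p] by blast
  have v0: "v \<noteq> 0" using uv(1) by auto
  have pr: "prime (int p)" using p by simp
  have key: "p_cong p 1 a (of_nat r) \<longleftrightarrow> int p dvd u - int r * v" for r
  proof
    assume "int p dvd u - int r * v"
    then obtain t where t: "u - int r * v = int p * t" ..
    have "(of_int (u - int r * v) :: rat) = of_int (int p * t)" using t by simp
    then have "(a - of_nat r) / of_nat (p ^ 1) = of_int t / of_int v"
      using v0 p0 uv(2) by (simp add: field_simps)
    then show "p_cong p 1 a (of_nat r)"
      unfolding p_cong_def p_integers_iff[OF p] using uv(1) by blast
  next
    assume "p_cong p 1 a (of_nat r)"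
    then obtain s t :: int where st: "\<not> int p dvd t"
      "(a - of_nat r) / of_nat (p ^ 1) = of_int s / of_int t"
      unfolding p_cong_def p_integers_iff[OF p] by blast
    have "t \<noteq> 0" using st(1) by auto
    then have "(of_int ((u - int r * v) * t) :: rat) = of_int (int p * (s * v))"
      using st(2) v0 p0 uv(2) by (simp add: field_simps)
    then have "(u - int r * v) * t = int p * (s * v)" by (simp only: of_int_eq_iff)
    then have "int p dvd (u - int r * v) * t" by simp
    then show "int p dvd u - int r * v" using st(1) pr by (simp add: prime_dvd_mult_iff)
  qed
  have "coprime v (int p)" using uv(1) pr by (metis coprime_commute prime_imp_coprime)
  then obtain w where w: "[v * w = 1] (mod int p)" using cong_solve_coprime_int by blast
  define r where "r = nat ((u * w) mod int p)"
  have r: "int r = (u * w) mod int p" using p0 by (simp add: r_def)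
  then have "r < p" using p0 by (metis of_nat_0_less_iff of_nat_less_iff pos_mod_bound)
  moreover have "[int r * v = u * (v * w)] (mod int p)"
    unfolding r cong_def by (simp add: mod_simps ac_simps)
  then have "[int r * v = u] (mod int p)"
    using w cong_scalar_left[OF w, of u] cong_trans by fastforce
  then have "int p dvd u - int r * v" using cong_sym cong_iff_dvd_diff by blast
  ultimately have ex: "r \<in> {0..p - 1} \<and> p_cong p 1 a (of_nat r)" using key by auto
  moreover have "r' = r" if "r' \<in> {0..p - 1} \<and> p_cong p 1 a (of_nat r')" for r'
  proof -
    have "int p dvd (u - int r' * v) - (u - int r * v)"
      using that ex key by (metis dvd_diff)
    then have "int p dvd (int r - int r') * v" by (simp add: algebra_simps)
    then have "int p dvd int r - int r'" using uv(1) pr by (simp add: prime_dvd_mult_iff)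
    moreover have "\<bar>int r - int r'\<bar> < int p" using that \<open>r < p\<close> p0 by auto
    ultimately have "int r - int r' = 0" using dvd_imp_le_int[of "int r - int r'" "int p"] by (cases "int r - int r' = 0") auto
    then show ?thesis by simp
  qed
  ultimately show ?thesis by blast
qed

end

theory Submission
  imports Defs "HOL-Computational_Algebra.Formal_Power_Series"
begin

text \<open>Write $S(x) = \sum_{k < p} \binom xk (-2)^k$ and $a = pt + r$ with $r = \langle a\rangle_p$.
  Then $S(x + 1) + S(x) = 2^p \binom x{p-1}$, where
  $\binom{pt + k - 1}{p - 1} \equiv pt/k \pmod{p^2}$ for $0 < k < p$, while
  $E_{p-2}(x + 1) + E_{p-2}(x) = 2 x^{p-2}$ with $k^{p-2} \equiv 1/k \pmod p$. Hence both sides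
  of the congruence change in the same way along $pt, pt + 1, \ldots, pt + p - 1$, and only the
  case $r = 0$ is left. There both sides reduce to $1 - pt \sum_{0 < k < p} (-1)^k/k$, as one
  sees by following each recurrence once around all residues modulo $p$.\<close>

section \<open>Euler polynomials\<close>

lemma euler_number_Ints: "euler_number n \<in> \<int>"
proof (induction n rule: less_induct)
  case (less n)
  have "euler_number (n - 2 * k) \<in> \<int>" if "k \<in> {1..n div 2}" "n \<noteq> 0" for k
    using that by (intro less.IH) auto
  then show ?case
    by (subst euler_number.simps) (auto intro!: Ints_minus Ints_sum Ints_mult)
qed

text \<open>The defining recurrence with its \<open>k = 0\<close> term restored; the parity filter
  over all indices gives it the shape of a Cauchy product.\<close>

lemma sum_even_euler_number:
  assumes "n > 0"
  shows "(\<Sum>i = 0..n. if even i then of_nat (n choose i) * euler_number (n - i) else 0) = 0"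
proof -
  have "(\<Sum>i = 0..n. if even i then of_nat (n choose i) * euler_number (n - i) else 0)
      = (\<Sum>i \<in> {i \<in> {0..n}. even i}. of_nat (n choose i) * euler_number (n - i))"
    by (rule sum.inter_filter[symmetric]) simp
  also have "\<dots> = (\<Sum>k = 0..n div 2. of_nat (n choose (2 * k)) * euler_number (n - 2 * k))"
    by (rule sum.reindex_bij_witness[of _ "\<lambda>k. 2 * k" "\<lambda>i. i div 2"]) auto
  also have "\<dots> = euler_number n
      + (\<Sum>k = 1..n div 2. of_nat (n choose (2 * k)) * euler_number (n - 2 * k))"
    by (subst sum.atLeast_Suc_atMost) auto
  also have "\<dots> = 0"
    using assms by (subst euler_number.simps) simp
  finally show ?thesis .
qed

text \<open>The hyperbolic secant: the next lemma identifies it as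
  \<open>2 / (exp X + exp (- X))\<close>.\<close>

definition euler_number_egf :: "rat fps" where
  "euler_number_egf = Abs_fps (\<lambda>n. euler_number n / fact n)"

context
  includes fps_syntax
begin

text \<open>Odd coefficients of the first factor cancel and even ones double, so each coefficient of
  the product is the recurrence sum times \<open>2 / fact n\<close>.\<close>

lemma euler_number_egf_cosh:
  "(fps_exp 1 + fps_exp (- 1)) * euler_number_egf = 2"
proof (rule fps_ext)
  fix n
  have c: "(fps_exp 1 + fps_exp (- 1)) $ i * euler_number_egf $ (n - i)
      = 2 / fact n * (if even i then of_nat (n choose i) * euler_number (n - i) else 0)"
    if "i \<in> {0..n}" for i
    using that by (auto simp: euler_number_egf_def binomial_fact field_simps)
  have "((fps_exp 1 + fps_exp (- 1)) * euler_number_egf) $ n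
      = 2 / fact n * (\<Sum>i = 0..n. if even i then of_nat (n choose i) * euler_number (n - i) else 0)"
    unfolding fps_mult_nth sum_distrib_left
    by (rule sum.cong) (simp_all only: c)
  also have "\<dots> = (2 :: rat fps) $ n"
    using sum_even_euler_number[of n]
    by (cases "n = 0") (simp_all add: euler_number.simps[of 0] fps_numeral_nth)
  finally show "((fps_exp 1 + fps_exp (- 1)) * euler_number_egf) $ n = (2 :: rat fps) $ n" .
qed

text \<open>The factor \<open>2 ^ n\<close> amounts to reading the usual generating series of the
  Euler polynomials at \<open>2 X\<close>; it cancels the \<open>1 / 2 ^ n\<close> in their
  definition.\<close>

lemma euler_polynomial_egf:
  "(fps_exp (2 * x - 1) * euler_number_egf) $ n = 2 ^ n * euler_polynomial n x / fact n"
proof -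
  have "(fps_exp (2 * x - 1) * euler_number_egf) $ n
      = (\<Sum>i = 0..n. (2 * x - 1) ^ (n - i) / fact (n - i) * (euler_number i / fact i))"
    unfolding fps_mult_nth
    by (rule sum.reindex_bij_witness[of _ "\<lambda>i. n - i" "\<lambda>i. n - i"])
       (auto simp: euler_number_egf_def)
  also have "\<dots> = (\<Sum>k = 0..n. of_nat (n choose k) * (2 * x - 1) ^ (n - k) * euler_number k) / fact n"
    unfolding sum_divide_distrib
    by (rule sum.cong) (auto simp: binomial_fact field_simps)
  finally show ?thesis by (simp add: euler_polynomial_def)
qed

text \<open>Factoring out \<open>fps_exp (2 * x)\<close> leaves \<open>exp X + exp (- X)\<close>,
  which cancels the secant.\<close>

lemma euler_polynomial_plus_1:
  "euler_polynomial n (x + 1) + euler_polynomial n x = 2 * x ^ n"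
proof -
  have "fps_exp (2 * (x + 1) - 1) = fps_exp (2 * x) * fps_exp (1 :: rat)"
    "fps_exp (2 * x - 1) = fps_exp (2 * x) * fps_exp (- 1 :: rat)"
    by (simp_all add: fps_exp_add_mult[symmetric] algebra_simps)
  then have "fps_exp (2 * (x + 1) - 1) * euler_number_egf + fps_exp (2 * x - 1) * euler_number_egf
      = fps_exp (2 * x) * ((fps_exp 1 + fps_exp (- 1)) * euler_number_egf)"
    by (simp add: algebra_simps)
  also have "\<dots> = fps_const 2 * fps_exp (2 * x)"
    unfolding euler_number_egf_cosh by (simp add: fps_numeral_fps_const)
  finally have "(fps_exp (2 * (x + 1) - 1) * euler_number_egf
      + fps_exp (2 * x - 1) * euler_number_egf) $ n = (fps_const 2 * fps_exp (2 * x)) $ n"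
    by simp
  then have "2 ^ n * euler_polynomial n (x + 1) / fact n + 2 ^ n * euler_polynomial n x / fact n
      = 2 * ((2 * x) ^ n / fact n)"
    unfolding fps_add_nth euler_polynomial_egf by simp
  then have "2 ^ n * (euler_polynomial n (x + 1) + euler_polynomial n x) = 2 ^ n * (2 * x ^ n)"
    by (simp add: field_simps)
  then show ?thesis by (metis mult_left_cancel power_not_zero zero_neq_numeral)
qed

end

section \<open>Truncated binomial sums\<close>

definition binom_sum :: "nat \<Rightarrow> rat \<Rightarrow> rat" where
  "binom_sum n x = (\<Sum>k = 0..n. (x gchoose k) * (- 2) ^ k)"

text \<open>By Pascal's rule the new terms contain \<open>(x gchoose n) * (- 2) ^ Suc n\<close>,
  which cancels the value from the induction hypothesis.\<close>

lemma binom_sum_plus_1: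
  "binom_sum n (x + 1) + binom_sum n x = 2 * (- 2) ^ n * (x gchoose n)"
proof (induction n)
  case 0
  then show ?case by (simp add: binom_sum_def)
next
  case (Suc n)
  have "binom_sum (Suc n) (x + 1) + binom_sum (Suc n) x
      = (binom_sum n (x + 1) + binom_sum n x)
        + ((x + 1 gchoose Suc n) + (x gchoose Suc n)) * (- 2) ^ Suc n"
    by (simp add: binom_sum_def algebra_simps)
  also have "\<dots> = 2 * (- 2) ^ Suc n * (x gchoose Suc n)"
    unfolding Suc.IH gbinomial_Suc_Suc by (simp add: algebra_simps)
  finally show ?case .
qed

lemma binom_sum_0: "binom_sum n 0 = 1"
  unfolding binom_sum_def
  using binomial_gbinomial[of 0, where 'a = rat, symmetric]
  by (subst sum.atLeast_Suc_atMost) (auto simp: binomial_eq_0 intro!: sum.neutral)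

section \<open>Congruences\<close>

context
  fixes p :: nat
  assumes p: "prime p"
begin

section \<open>Arithmetic of p-integral rationals\<close>

lemma p_integers_of_int [simp]: "of_int i \<in> p_integers p"
  unfolding p_integers_iff[OF p]
  by (rule exI[of _ i], rule exI[of _ 1]) (use p in auto)

lemma p_integers_of_nat [simp]: "of_nat n \<in> p_integers p"
  using p_integers_of_int[of "int n"] by simp

lemma p_integers_numeral [simp]: "numeral n \<in> p_integers p"
  using p_integers_of_int[of "numeral n"] by simp

lemma p_integers_0_1 [simp]: "0 \<in> p_integers p" "1 \<in> p_integers p"
  using p_integers_of_int[of 0] p_integers_of_int[of 1] by simp_all

lemma p_integers_add:
  assumes "x \<in> p_integers p" "y \<in> p_integers p"
  shows "x + y \<in> p_integers p"
proof -
  obtain u v u' v' :: int where *: "\<not> int p dvd v" "x = of_int u / of_int v"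
    "\<not> int p dvd v'" "y = of_int u' / of_int v'"
    using assms unfolding p_integers_iff[OF p] by blast
  then have "\<not> int p dvd v * v'" using p by (simp add: prime_dvd_mult_iff)
  moreover have "v \<noteq> 0" "v' \<noteq> 0" using * by auto
  then have "x + y = of_int (u * v' + u' * v) / of_int (v * v')"
    using * by (simp add: field_simps)
  ultimately show ?thesis unfolding p_integers_iff[OF p] by blast
qed

lemma p_integers_mult:
  assumes "x \<in> p_integers p" "y \<in> p_integers p"
  shows "x * y \<in> p_integers p"
proof -
  obtain u v u' v' :: int where *: "\<not> int p dvd v" "x = of_int u / of_int v"
    "\<not> int p dvd v'" "y = of_int u' / of_int v'"
    using assms unfolding p_integers_iff[OF p] by blast
  then have "\<not> int p dvd v * v'" using p by (simp add: prime_dvd_mult_iff)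
  moreover have "x * y = of_int (u * u') / of_int (v * v')"
    using * by simp
  ultimately show ?thesis unfolding p_integers_iff[OF p] by blast
qed

lemma p_integers_uminus: "x \<in> p_integers p \<Longrightarrow> - x \<in> p_integers p"
  using p_integers_mult[OF p_integers_of_int[of "- 1"]] by simp

lemma p_integers_diff: "x \<in> p_integers p \<Longrightarrow> y \<in> p_integers p \<Longrightarrow> x - y \<in> p_integers p"
  using p_integers_add[of x "- y"] p_integers_uminus[of y] by simp

lemma p_integers_power: "x \<in> p_integers p \<Longrightarrow> x ^ n \<in> p_integers p"
  by (induction n) (auto intro: p_integers_mult)

lemma p_integers_sum: "(\<And>i. i \<in> A \<Longrightarrow> f i \<in> p_integers p) \<Longrightarrow> sum f A \<in> p_integers p"
  by (induction A rule: infinite_finite_induct) (auto intro: p_integers_add)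

lemma p_integers_inverse_of_nat: "\<not> p dvd k \<Longrightarrow> 1 / of_nat k \<in> p_integers p"
  unfolding p_integers_iff[OF p]
  by (rule exI[of _ 1], rule exI[of _ "int k"]) (auto intro: gr0I)

lemmas p_integers_intros = p_integers_add p_integers_mult p_integers_uminus p_integers_diff
  p_integers_power p_integers_sum

section \<open>Calculus of congruences modulo powers of \<open>p\<close>\<close>

lemma p_cong_iff: "p_cong p m x y \<longleftrightarrow> (\<exists>z \<in> p_integers p. x = y + of_nat p ^ m * z)"
proof -
  have "p > 0" using p by (rule prime_gt_0_nat)
  then have "x = y + of_nat p ^ m * z \<longleftrightarrow> (x - y) / of_nat (p ^ m) = z" for z :: rat
    by (auto simp: field_simps)
  then show ?thesis by (simp add: p_cong_def)
qed

lemma p_congI: "x - y = of_nat p ^ m * z \<Longrightarrow> z \<in> p_integers p \<Longrightarrow> p_cong p m x y"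
  unfolding p_cong_iff by (rule bexI[of _ z]) (auto simp: algebra_simps)

lemma p_congE:
  assumes "p_cong p m x y"
  obtains z where "z \<in> p_integers p" "x = y + of_nat p ^ m * z"
  using assms unfolding p_cong_iff by blast

lemma p_cong_refl [simp]: "p_cong p m x x"
  by (rule p_congI[where z = 0]) auto

lemma p_cong_sym: "p_cong p m x y \<Longrightarrow> p_cong p m y x"
  by (erule p_congE, rule p_congI[where z = "- _"]) (auto intro: p_integers_uminus)

lemma p_cong_trans [trans]: "p_cong p m x y \<Longrightarrow> p_cong p m y z \<Longrightarrow> p_cong p m x z"
  by (elim p_congE, rule p_congI[where z = "_ + _"])
     (auto intro: p_integers_add simp: algebra_simps)

lemma p_cong_add: "p_cong p m x y \<Longrightarrow> p_cong p m x' y' \<Longrightarrow> p_cong p m (x + x') (y + y')"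
  by (elim p_congE, rule p_congI[where z = "_ + _"])
     (auto intro: p_integers_add simp: algebra_simps)

lemma p_cong_cmult: "p_cong p m x y \<Longrightarrow> c \<in> p_integers p \<Longrightarrow> p_cong p m (c * x) (c * y)"
  by (elim p_congE, rule p_congI[where z = "c * _"])
     (auto intro: p_integers_mult simp: algebra_simps)

lemma p_cong_uminus: "p_cong p m x y \<Longrightarrow> p_cong p m (- x) (- y)"
  using p_cong_cmult[of m x y "- 1"] by (simp add: p_integers_uminus)

lemma p_cong_diff: "p_cong p m x y \<Longrightarrow> p_cong p m x' y' \<Longrightarrow> p_cong p m (x - x') (y - y')"
  using p_cong_add[of m x y "- x'" "- y'"] p_cong_uminus[of m x' y'] by simp

lemma p_cong_mult:
  assumes "p_cong p m x y" "p_cong p m x' y'" "x \<in> p_integers p" "y' \<in> p_integers p"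
  shows "p_cong p m (x * x') (y * y')"
  using p_cong_trans[OF p_cong_cmult[OF assms(2,3)]] p_cong_cmult[OF assms(1,4)]
  by (simp add: mult.commute)

lemma p_cong_sum:
  "(\<And>i. i \<in> A \<Longrightarrow> p_cong p m (f i) (g i)) \<Longrightarrow> p_cong p m (sum f A) (sum g A)"
  by (induction A rule: infinite_finite_induct) (auto intro: p_cong_add)

lemma p_cong_power:
  assumes "p_cong p m x y" "x \<in> p_integers p" "y \<in> p_integers p"
  shows "p_cong p m (x ^ n) (y ^ n)"
  using assms by (induction n) (auto intro!: p_cong_mult p_integers_power)

text \<open>Trades a factor \<open>p\<close> for one power of the modulus: once a \<open>p\<close>
  is extracted, the cofactors matter only to one order less.\<close>

lemma p_cong_Suc_iff: "p_cong p (Suc m) (of_nat p * x) (of_nat p * y) \<longleftrightarrow> p_cong p m x y"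
proof -
  have "of_nat p \<noteq> (0 :: rat)" using p by (auto simp: prime_gt_0_nat)
  then have "(of_nat p * x - of_nat p * y) / of_nat (p ^ Suc m) = (x - y) / of_nat (p ^ m)"
    by (simp add: right_diff_distrib[symmetric])
  then show ?thesis by (simp only: p_cong_def)
qed

lemma p_cong_2_iff: "p_cong p 2 (of_nat p * x) (of_nat p * y) \<longleftrightarrow> p_cong p 1 x y"
  using p_cong_Suc_iff[of 1] by (simp only: Suc_1)

lemma p_cong_2_imp_1: "p_cong p 2 x y \<Longrightarrow> p_cong p 1 x y"
  by (erule p_congE, rule p_congI[where z = "of_nat p * _"])
     (auto intro: p_integers_mult simp: power2_eq_square)

lemma p_cong_of_nat_mult_0: "z \<in> p_integers p \<Longrightarrow> p_cong p 1 (of_nat p * z) 0"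
  by (rule p_congI[where z = z]) auto

lemma p_cong_cancel:
  assumes "\<not> p dvd k" "p_cong p m (of_nat k * x) (of_nat k * y)"
  shows "p_cong p m x y"
proof -
  have "k \<noteq> 0" using assms(1) by (cases k) auto
  then show ?thesis
    using p_cong_cmult[OF assms(2) p_integers_inverse_of_nat[OF assms(1)]] by simp
qed

lemma p_cong_of_nat: "[k = l] (mod p) \<Longrightarrow> p_cong p 1 (of_nat k) (of_nat l)"
proof -
  assume "[k = l] (mod p)"
  then have "int p dvd int k - int l"
    by (simp add: cong_int_iff[symmetric] cong_iff_dvd_diff)
  then obtain z where "int k - int l = int p * z" by auto
  then have "(of_int (int k - int l) :: rat) = of_int (int p * z)" by simp
  then show ?thesis by (intro p_congI[where z = "of_int z"]) auto
qed

section \<open>Binomial coefficients modulo \<open>p\<close> and \<open>p ^ 2\<close>\<close>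

lemma p_integers_gbinomial:
  assumes x: "x \<in> p_integers p"
  shows "k < p \<Longrightarrow> (x gchoose k) \<in> p_integers p"
proof (induction k)
  case (Suc k)
  have "(x gchoose Suc k) = (1 / of_nat (Suc k)) * ((x - of_nat k) * (x gchoose k))"
    using gbinomial_mult_1[of x k] by (simp add: field_simps)
  \<comment> \<open>The bound \<open>Suc k < p\<close> keeps every denominator introduced by the
    recurrence prime to \<open>p\<close>.\<close>
  moreover have "\<not> p dvd Suc k" using Suc.prems by (auto dest: dvd_imp_le)
  ultimately show ?case
    using Suc x
    by (auto intro!: p_integers_mult p_integers_diff p_integers_inverse_of_nat simp only:
        p_integers_of_nat)
qed simp

text \<open>Modulo \<open>p\<close> the upper argument is \<open>- 1\<close>, and
  \<open>(- 1 gchoose k) = (- 1) ^ k\<close>; the induction divides only by numbers prime to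
  \<open>p\<close>.\<close>

lemma gbinomial_minus_1_cong:
  assumes t: "t \<in> p_integers p"
  shows "k < p \<Longrightarrow> p_cong p 1 (of_nat p * t - 1 gchoose k) ((- 1) ^ k)"
proof (induction k)
  case (Suc k)
  let ?x = "of_nat p * t - 1"
  have nd: "\<not> p dvd Suc k" using Suc.prems by (auto dest: dvd_imp_le)
  have x: "?x \<in> p_integers p" using t by (intro p_integers_intros) auto
  have "p_cong p 1 ((?x gchoose k) * (?x - of_nat k)) ((- 1) ^ k * (- of_nat (Suc k)))"
  proof (rule p_cong_mult)
    show "p_cong p 1 (?x gchoose k) ((- 1) ^ k)" using Suc by simp
    show "p_cong p 1 (?x - of_nat k) (- of_nat (Suc k))"
      by (rule p_congI[OF _ t]) simp
  qed (use Suc.prems x in \<open>auto intro!: p_integers_gbinomial p_integers_uminus simp del: of_nat_Suc\<close>)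
  moreover have "(?x gchoose k) * (?x - of_nat k) = of_nat (Suc k) * (?x gchoose Suc k)"
    using gbinomial_mult_1[of ?x k] by (simp add: algebra_simps)
  ultimately have "p_cong p 1 (of_nat (Suc k) * (?x gchoose Suc k)) (of_nat (Suc k) * (- 1) ^ Suc k)"
    by (simp add: algebra_simps)
  then show ?case by (rule p_cong_cancel[OF nd])
qed simp

text \<open>Absorption pulls out the factor \<open>of_nat p * t\<close>, leaving a binomial
  coefficient that is needed only modulo \<open>p\<close>.\<close>

lemma gbinomial_p_mult_cong:
  assumes t: "t \<in> p_integers p" and k: "0 < k" "k < p"
  shows "p_cong p 2 (of_nat p * t gchoose k) (of_nat p * (t * ((- 1) ^ (k - 1) / of_nat k)))"
proof -
  have "\<not> p dvd k" using k by (auto dest: dvd_imp_le)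
  then have "p_cong p 1 ((t * (1 / of_nat k)) * (of_nat p * t - 1 gchoose (k - 1)))
      ((t * (1 / of_nat k)) * (- 1) ^ (k - 1))"
    using t k by (intro p_cong_cmult gbinomial_minus_1_cong p_integers_mult
        p_integers_inverse_of_nat) auto
  then have "p_cong p 2 (of_nat p * ((t * (1 / of_nat k)) * (of_nat p * t - 1 gchoose (k - 1))))
      (of_nat p * ((t * (1 / of_nat k)) * (- 1) ^ (k - 1)))"
    by (simp only: p_cong_2_iff)
  moreover have "(of_nat p * t gchoose k)
      = of_nat p * ((t * (1 / of_nat k)) * (of_nat p * t - 1 gchoose (k - 1)))"
    using gbinomial_absorption[of "k - 1" "of_nat p * t"] k by (simp add: field_simps)
  ultimately show ?thesis by simp
qed

context
  assumes odd_p: "odd p"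
begin

lemma p_ge_3: "p \<ge> 3"
  using prime_ge_2_nat[OF p] odd_p by (cases "p = 2") auto

lemma p_not_dvd_2_power: "\<not> p dvd 2 ^ n"
  using prime_dvd_power_nat[OF p, of 2 n] dvd_imp_le[of p 2] p_ge_3 by linarith

lemma p_not_dvd_2: "\<not> p dvd 2"
  using p_not_dvd_2_power[of 1] by simp

text \<open>The product \<open>k * D k\<close> stays constant modulo \<open>p ^ 2\<close>: its
  increment is \<open>p\<close> times a combination of values of \<open>D\<close> that vanish modulo
  \<open>p\<close>.\<close>

lemma gbinomial_last_cong:
  assumes t: "t \<in> p_integers p" and k: "0 < k" "k < p"
  shows "p_cong p 2 (of_nat p * t + of_nat k - 1 gchoose (p - 1)) (of_nat p * (t / of_nat k))"
proof -
  define D where "D k = (of_nat p * t + of_nat k - 1 gchoose (p - 1))" for k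
  have D_int: "D k \<in> p_integers p" for k
    unfolding D_def using t p_ge_3
    by (intro p_integers_gbinomial p_integers_intros) auto
  have "p_cong p 2 (of_nat k * D k) (of_nat p * t)"
    using k
  proof (induction k rule: nat_induct_non_zero)
    case 1
    have nd: "\<not> p dvd (p - 1)" using p_ge_3 by (auto dest: dvd_imp_le)
    \<comment> \<open>As \<open>p - 1 - 1\<close> is odd, the left side is \<open>- 1\<close>; the
      two sides differ by exactly \<open>- p\<close>, whence the witness.\<close>
    have "p_cong p 1 (of_nat (p - 1) * ((- 1) ^ (p - 1 - 1) / of_nat (p - 1))) (of_nat (p - 1) * 1)"
      using p_ge_3 odd_p by (intro p_congI[where z = "- 1"]) (auto intro: p_integers_uminus simp: of_nat_diff)
    from p_cong_cancel[OF nd this]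
    have "p_cong p 1 (t * ((- 1) ^ (p - 1 - 1) / of_nat (p - 1))) (t * 1)"
      using t by (rule p_cong_cmult)
    then have last: "p_cong p 2 (of_nat p * (t * ((- 1) ^ (p - 1 - 1) / of_nat (p - 1)))) (of_nat p * (t * 1))"
      by (simp only: p_cong_2_iff)
    have "p_cong p 2 (of_nat p * t gchoose (p - 1)) (of_nat p * (t * 1))"
      by (rule p_cong_trans[OF gbinomial_p_mult_cong[OF t] last]) (use p_ge_3 in auto)
    then show ?case by (simp add: D_def)
  next
    case (Suc k)
    have nd: "\<not> p dvd k" "\<not> p dvd Suc k" using Suc by (auto dest: dvd_imp_le)
    \<comment> \<open>Absorption gives
      \<open>(p * t + k - (p - 1)) * D (k + 1) = (p * t + k) * D k\<close>; the multiples of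
      \<open>p\<close> are collected on the right.\<close>
    have "of_nat (Suc k) * D (Suc k)
        = of_nat k * D k + of_nat p * (t * D k - (t - 1) * D (Suc k))"
      using gbinomial_absorb_comp[of "of_nat p * t + of_nat k" "p - 1"] p_ge_3
      by (simp add: D_def of_nat_diff algebra_simps)
    note rec = this
    have kD: "p_cong p 2 (of_nat k * D k) (of_nat p * t)" using Suc by simp
    have kD0: "p_cong p 1 (of_nat k * D k) 0"
      by (rule p_cong_trans[OF p_cong_2_imp_1[OF kD] p_cong_of_nat_mult_0[OF t]])
    then have D0: "p_cong p 1 (D k) 0"
      using p_cong_cancel[OF nd(1), of 1 "D k" 0] by simp
    \<comment> \<open>First pass through \<open>rec\<close>, modulo \<open>p\<close> only:
      \<open>D (Suc k)\<close> vanishes, hence so does the bracket in the second pass modulo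
      \<open>p ^ 2\<close>.\<close>
    have "p_cong p 1 (of_nat (Suc k) * D (Suc k)) (0 + 0)"
      unfolding rec
      by (intro p_cong_add kD0 p_cong_of_nat_mult_0 p_integers_intros t D_int p_integers_0_1)
    then have D0': "p_cong p 1 (D (Suc k)) 0"
      using p_cong_cancel[OF nd(2), of 1 "D (Suc k)" 0] by simp
    have "p_cong p 1 (t * D k - (t - 1) * D (Suc k)) (t * 0 - (t - 1) * 0)"
      by (intro p_cong_diff p_cong_cmult D0 D0' p_integers_intros t p_integers_0_1)
    then have "p_cong p 2 (of_nat p * (t * D k - (t - 1) * D (Suc k))) (of_nat p * 0)"
      unfolding p_cong_2_iff by simp
    from p_cong_add[OF kD this] show ?case
      unfolding rec by simp
  qed
  moreover have "\<not> p dvd k" using k by (auto dest: dvd_imp_le)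
  ultimately show ?thesis
    using k p_cong_cancel[of k 2 "D k" "of_nat p * (t / of_nat k)"] by (simp add: D_def)
qed

lemma p_cong_fermat:
  assumes "\<not> p dvd k"
  shows "p_cong p 1 (of_nat k ^ (p - 1)) 1"
  using p_cong_of_nat[OF fermat_theorem[OF p assms]] by simp

section \<open>The truncated binomial sum modulo \<open>p ^ 2\<close>\<close>

lemma binom_sum_plus_1_p:
  "binom_sum (p - 1) (x + 1) + binom_sum (p - 1) x = 2 ^ p * (x gchoose (p - 1))"
proof -
  have "2 * (- 2) ^ (p - 1) = (2 :: rat) ^ p"
    using odd_p p_ge_3 by (simp add: power_eq_if[of _ p])
  then show ?thesis using binom_sum_plus_1[of "p - 1" x] by simp
qed

text \<open>The binomial coefficient already carries a factor \<open>p\<close>, so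
  \<open>2 ^ p\<close> is needed only modulo \<open>p\<close>, where Fermat's theorem makes it
  2.\<close>

lemma binom_sum_step_cong:
  assumes t: "t \<in> p_integers p" and k: "0 < k" "k < p"
  shows "p_cong p 2
    (binom_sum (p - 1) (of_nat p * t + of_nat k) + binom_sum (p - 1) (of_nat p * t + of_nat k - 1))
    (of_nat p * (2 * t / of_nat k))"
proof -
  let ?D = "of_nat p * t + of_nat k - 1 gchoose (p - 1)"
  have nd: "\<not> p dvd k" using k by (auto dest: dvd_imp_le)
  have tk: "t * (1 / of_nat k) \<in> p_integers p"
    using t nd by (intro p_integers_mult p_integers_inverse_of_nat)
  have "p_cong p 1 (2 * of_nat 2 ^ (p - 1)) (2 * 1)"
    by (intro p_cong_cmult p_cong_fermat p_not_dvd_2) simp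
  then have "p_cong p 1 (2 ^ p) 2"
    using p_ge_3 by (simp add: power_eq_if[of _ p])
  from p_cong_cmult[OF this tk]
  have 2: "p_cong p 2 (of_nat p * (t * (1 / of_nat k) * 2 ^ p)) (of_nat p * (t * (1 / of_nat k) * 2))"
    by (simp only: p_cong_2_iff)
  have "p_cong p 2 (2 ^ p * ?D) (2 ^ p * (of_nat p * (t / of_nat k)))"
    using gbinomial_last_cong[OF t k] by (rule p_cong_cmult) (simp add: p_integers_power)
  also have "2 ^ p * (of_nat p * (t / of_nat k)) = of_nat p * (t * (1 / of_nat k) * 2 ^ p)"
    by simp
  also note 2
  also have "of_nat p * (t * (1 / of_nat k) * 2) = of_nat p * (2 * t / of_nat k)"
    by simp
  finally have "p_cong p 2 (2 ^ p * ?D) (of_nat p * (2 * t / of_nat k))" .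
  then show ?thesis
    using binom_sum_plus_1_p[of "of_nat p * t + of_nat k - 1"] by simp
qed

text \<open>The correction that both recurrences accumulate over \<open>n\<close> unit steps, up to
  a constant factor.\<close>

definition alt_harm :: "nat \<Rightarrow> rat" where
  "alt_harm n = (\<Sum>k = 1..n. (- 1) ^ k / of_nat k)"

text \<open>The sign \<open>(- 1) ^ j\<close> turns the recurrence for sums of neighbours into a
  telescoping one, each step adding one term of \<open>alt_harm\<close>.\<close>

lemma binom_sum_shift_cong:
  assumes t: "t \<in> p_integers p"
  shows "j < p \<Longrightarrow> p_cong p 2 ((- 1) ^ j * binom_sum (p - 1) (of_nat p * t + of_nat j))
    (binom_sum (p - 1) (of_nat p * t) + of_nat p * (2 * t * alt_harm j))"
proof (induction j)
  case 0
  then show ?case by (simp add: alt_harm_def)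
next
  case (Suc j)
  let ?S = "binom_sum (p - 1)"
  have "p_cong p 2 ((- 1) ^ Suc j * (?S (of_nat p * t + of_nat (Suc j)) + ?S (of_nat p * t + of_nat (Suc j) - 1)))
      ((- 1) ^ Suc j * (of_nat p * (2 * t / of_nat (Suc j))))"
    using Suc.prems
    by (intro p_cong_cmult binom_sum_step_cong[OF t] p_integers_power p_integers_uminus) auto
  from p_cong_add[OF this Suc.IH] Suc.prems show ?case
    by (simp add: alt_harm_def algebra_simps)
qed

text \<open>Each term with \<open>k > 0\<close> is linear in \<open>t\<close> modulo
  \<open>p ^ 2\<close>. The coefficient does not depend on \<open>t\<close>, so special values of
  \<open>t\<close> can determine it.\<close>

lemma binom_sum_p_mult_cong_aux:
  assumes t: "t \<in> p_integers p"
  shows "p_cong p 2 (binom_sum (p - 1) (of_nat p * t))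
    (1 + of_nat p * (t * (\<Sum>k = 1..p - 1. (- 1) ^ (k - 1) / of_nat k * (- 2) ^ k)))"
proof -
  have "p_cong p 2 (\<Sum>k = 1..p - 1. (- 2) ^ k * (of_nat p * t gchoose k))
      (\<Sum>k = 1..p - 1. (- 2) ^ k * (of_nat p * (t * ((- 1) ^ (k - 1) / of_nat k))))"
    using t by (intro p_cong_sum p_cong_cmult gbinomial_p_mult_cong p_integers_power p_integers_uminus) auto
  also have "(\<Sum>k = 1..p - 1. (- 2) ^ k * (of_nat p * (t * ((- 1) ^ (k - 1) / of_nat k))))
      = of_nat p * (t * (\<Sum>k = 1..p - 1. (- 1) ^ (k - 1) / of_nat k * (- 2) ^ k))"
    by (simp add: sum_distrib_left ac_simps)
  finally have "p_cong p 2 (1 + (\<Sum>k = 1..p - 1. (- 2) ^ k * (of_nat p * t gchoose k)))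
      (1 + of_nat p * (t * (\<Sum>k = 1..p - 1. (- 1) ^ (k - 1) / of_nat k * (- 2) ^ k)))"
    by (intro p_cong_add p_cong_refl)
  moreover have "binom_sum (p - 1) (of_nat p * t)
      = 1 + (\<Sum>k = 1..p - 1. (- 2) ^ k * (of_nat p * t gchoose k))"
    unfolding binom_sum_def by (subst sum.atLeast_Suc_atMost) (auto simp: mult.commute)
  ultimately show ?thesis by simp
qed

text \<open>The sum above is evaluated modulo $p$ by walking in unit steps from $-p$ to $0$ and
  from $0$ to $p$. The last step of each walk falls outside the range of the shift congruence,
  but there the binomial coefficient in the recurrence is exactly $1$.\<close>

lemma binom_sum_p_mult_cong:
  assumes t: "t \<in> p_integers p"
  shows "p_cong p 2 (binom_sum (p - 1) (of_nat p * t)) (1 - of_nat p * (t * alt_harm (p - 1)))"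
proof -
  let ?S = "binom_sum (p - 1)" and ?P = "of_nat p :: rat" and ?T = "alt_harm (p - 1)"
  define c :: rat where "c = (\<Sum>k = 1..p - 1. (- 1) ^ (k - 1) / of_nat k * (- 2) ^ k)"
  have c: "p_cong p 2 (?S (?P * t)) (1 + ?P * (t * c))" if "t \<in> p_integers p" for t
    using binom_sum_p_mult_cong_aux[OF that] by (simp only: c_def)
  have P: "of_nat (p - 1) = ?P - 1" and even: "even (p - 1)"
    using p_ge_3 odd_p by (auto simp: of_nat_diff)
  have m1: "- 1 \<in> p_integers p" by (simp add: p_integers_uminus)
  have one: "(?P - 1 gchoose (p - 1)) = 1" "(- 1 :: rat) gchoose (p - 1) = 1"
    using binomial_gbinomial[of "p - 1" "p - 1", where 'a = rat] P
      gbinomial_minus[of "1 :: rat" "p - 1"] even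
    by simp_all
  have "?S (- 1) = 2 ^ p - 1"
    using binom_sum_plus_1_p[of "- 1"] one by (simp add: binom_sum_0)
  \<comment> \<open>The walk from \<open>- p\<close> up to \<open>- 1\<close>: the shift congruence
    at \<open>t = - 1\<close>, over \<open>p - 1\<close> steps.\<close>
  moreover have "p_cong p 2 (?S (- 1)) (?S (- ?P) + ?P * (- 2 * ?T))"
    using binom_sum_shift_cong[OF m1, of "p - 1"] P even p_ge_3 by simp
  ultimately have 1: "p_cong p 2 (2 ^ p - 1) (?S (- ?P) + ?P * (- 2 * ?T))" by simp
  have 2: "p_cong p 2 (?S (- ?P) + ?P * (- 2 * ?T)) ((1 + ?P * (- 1 * c)) + ?P * (- 2 * ?T))"
    using c[OF m1] by (intro p_cong_add p_cong_refl) simp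
  \<comment> \<open>The walk from 0 up to \<open>p - 1\<close>: at \<open>t = 0\<close> no
    correction arises.\<close>
  have 3: "p_cong p 2 (?S (?P - 1)) 1"
    using binom_sum_shift_cong[of 0 "p - 1"] P even p_ge_3 by (simp add: binom_sum_0)
  have "?S ?P = 2 ^ p - ?S (?P - 1)"
    using binom_sum_plus_1_p[of "?P - 1"] one by simp
  then have 4: "p_cong p 2 (?S ?P) (2 ^ p - 1)"
    using p_cong_diff[OF p_cong_refl 3, of "2 ^ p"] by simp
  have 5: "p_cong p 2 (1 + ?P * (1 * c)) (?S ?P)"
    using p_cong_sym[OF c[of 1]] by simp
  \<comment> \<open>Both walks meet in \<open>2 ^ p - 1\<close>. Since \<open>c\<close> enters with
    opposite signs at \<open>t = 1\<close> and \<open>t = - 1\<close>, comparing them determines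
    \<open>2 * c\<close> modulo \<open>p\<close>.\<close>
  have "p_cong p 2 (1 + ?P * (1 * c)) ((1 + ?P * (- 1 * c)) + ?P * (- 2 * ?T))"
    by (rule p_cong_trans[OF 5 p_cong_trans[OF 4 p_cong_trans[OF 1 2]]])
  from p_cong_add[OF this p_cong_refl, of "?P * c - 1"]
  have "p_cong p 2 (?P * (2 * c)) (?P * (2 * (- ?T)))"
    by (simp add: algebra_simps)
  then have "p_cong p 1 (of_nat 2 * c) (of_nat 2 * (- ?T))"
    by (simp only: p_cong_2_iff of_nat_numeral)
  then have "p_cong p 1 c (- ?T)"
    by (rule p_cong_cancel[OF p_not_dvd_2])
  from p_cong_cmult[OF this t]
  have "p_cong p 2 (?P * (t * c)) (?P * (t * (- ?T)))" by (simp only: p_cong_2_iff)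
  from p_cong_trans[OF c[OF t] p_cong_add[OF p_cong_refl this]] show ?thesis by simp
qed

section \<open>Euler polynomials modulo \<open>p\<close>\<close>

lemma euler_polynomial_cong:
  assumes "p_cong p 1 x y" "x \<in> p_integers p" "y \<in> p_integers p"
  shows "p_cong p 1 (euler_polynomial n x) (euler_polynomial n y)"
proof -
  \<comment> \<open>Integral Euler numbers, together with an odd \<open>p\<close> for the power of 2
    in the denominator, make all coefficients p-integral.\<close>
  have E: "euler_number k \<in> p_integers p" for k
    using euler_number_Ints[of k] by (auto elim: Ints_cases)
  have half: "1 / 2 ^ n \<in> p_integers p"
    using p_integers_inverse_of_nat[OF p_not_dvd_2_power[of n]] by simp
  have "p_cong p 1 (2 * x - 1) (2 * y - 1)"
    using assms by (intro p_cong_diff p_cong_cmult) auto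
  then show ?thesis
    unfolding euler_polynomial_def using assms half E
    by (intro p_cong_cmult p_cong_sum p_cong_mult p_cong_power p_cong_refl p_integers_intros) auto
qed

text \<open>Fermat's theorem turns the power into an inverse; the sign survives because
  \<open>p - 2\<close> is odd.\<close>

lemma p_cong_power_inverse:
  assumes "\<not> p dvd k"
  shows "p_cong p 1 ((- of_nat k) ^ (p - 2)) (- 1 / of_nat k)"
proof (rule p_cong_cancel[OF assms])
  have k: "k \<noteq> 0" using assms by (cases k) auto
  have "p - 1 = Suc (p - 2)" "odd (p - 2)" using p_ge_3 odd_p by auto
  then have "of_nat k * (- of_nat k) ^ (p - 2) = - ((of_nat k :: rat) ^ (p - 1))" by simp
  then show "p_cong p 1 (of_nat k * (- of_nat k) ^ (p - 2)) (of_nat k * (- 1 / of_nat k))"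
    using p_cong_uminus[OF p_cong_fermat[OF assms]] k by simp
qed

text \<open>The telescoping of \<open>binom_sum_shift_cong\<close>, now walking downwards, because
  the final congruence evaluates the polynomial at \<open>- a\<close>.\<close>

lemma euler_polynomial_shift_cong:
  "j < p \<Longrightarrow> p_cong p 1 ((- 1) ^ j * euler_polynomial (p - 2) (- of_nat j))
    (euler_polynomial (p - 2) 0 - 2 * alt_harm j)"
proof (induction j)
  case 0
  then show ?case by (simp add: alt_harm_def)
next
  case (Suc j)
  let ?e = "euler_polynomial (p - 2)"
  have "\<not> p dvd Suc j" using Suc.prems by (auto dest: dvd_imp_le)
  from p_cong_power_inverse[OF this]
  have "p_cong p 1 ((- 1) ^ Suc j * (2 * (- of_nat (Suc j)) ^ (p - 2)))
      ((- 1) ^ Suc j * (2 * (- 1 / of_nat (Suc j))))"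
    by (intro p_cong_cmult p_integers_power p_integers_uminus) auto
  moreover have "?e (- of_nat j) + ?e (- of_nat (Suc j)) = 2 * (- of_nat (Suc j)) ^ (p - 2)"
    using euler_polynomial_plus_1[of "p - 2" "- of_nat (Suc j)"] by simp
  ultimately have "p_cong p 1 ((- 1) ^ Suc j * (?e (- of_nat j) + ?e (- of_nat (Suc j))))
      ((- 1) ^ Suc j * (2 * (- 1 / of_nat (Suc j))))" by simp
  from p_cong_add[OF this Suc.IH] Suc.prems show ?case
    by (simp add: alt_harm_def algebra_simps)
qed

text \<open>After \<open>p\<close> steps the walk down from 0 is back at residue 0. Its last step
  contributes only a multiple of \<open>p\<close>, so the value at 0 returns with the opposite sign
  and is thereby determined.\<close>

lemma euler_polynomial_0_cong: "p_cong p 1 (euler_polynomial (p - 2) 0) (alt_harm (p - 1))"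
proof -
  let ?e = "euler_polynomial (p - 2)" and ?P = "of_nat p :: rat" and ?T = "alt_harm (p - 1)"
  have P: "of_nat (p - 1) = ?P - 1" and even: "even (p - 1)"
    using p_ge_3 odd_p by (auto simp: of_nat_diff)
  have 1: "p_cong p 1 (?e (1 - ?P)) (?e 0 - 2 * ?T)"
    using euler_polynomial_shift_cong[of "p - 1"] P even p_ge_3 by simp
  have "p_cong p 1 (- ?P) 0"
    by (rule p_congI[of _ _ _ "- 1"]) (auto intro: p_integers_uminus)
  then have 2: "p_cong p 1 (?e (- ?P)) (?e 0)"
    by (intro euler_polynomial_cong) (auto intro: p_integers_uminus)
  \<comment> \<open>The exponent \<open>p - 2\<close> is positive, so one factor \<open>- p\<close>
    can be split off the power.\<close>
  have "p - 2 = Suc (p - 3)" using p_ge_3 by simp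
  then have "?e (1 - ?P) + ?e (- ?P) = ?P * (- 2 * (- ?P) ^ (p - 3))"
    using euler_polynomial_plus_1[of "p - 2" "- ?P"] by simp
  moreover have "p_cong p 1 (?P * (- 2 * (- ?P) ^ (p - 3))) 0"
    by (intro p_cong_of_nat_mult_0 p_integers_mult p_integers_power p_integers_uminus) auto
  ultimately have "p_cong p 1 (?e (1 - ?P) + ?e (- ?P)) 0" by simp
  then have "p_cong p 1 ((?e 0 - 2 * ?T) + ?e 0) 0"
    by (rule p_cong_trans[OF p_cong_sym[OF p_cong_add[OF 1 2]]])
  from p_cong_add[OF this p_cong_refl, of "2 * ?T"]
  have "p_cong p 1 (of_nat 2 * ?e 0) (of_nat 2 * ?T)" by simp
  then show ?thesis
    by (rule p_cong_cancel[OF p_not_dvd_2])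
qed

text \<open>Up to the sign \<open>(- 1) ^ r\<close>, the same quantity
  \<open>alt_harm (p - 1) - 2 * alt_harm r\<close> is the coefficient of \<open>- p * t\<close> in
  the truncated sum and the value of the Euler polynomial modulo \<open>p\<close>.\<close>

lemma binom_sum_cong_euler_polynomial:
  assumes t: "t \<in> p_integers p" and r: "r < p"
  shows "p_cong p 2 (binom_sum (p - 1) (of_nat p * t + of_nat r))
    ((- 1) ^ r - of_nat p * (t * euler_polynomial (p - 2) (- (of_nat p * t + of_nat r))))"
proof -
  let ?S = "binom_sum (p - 1)" and ?P = "of_nat p :: rat" and ?e = "euler_polynomial (p - 2)"
  let ?x = "?P * t + of_nat r" and ?T = "alt_harm (p - 1)"
  have sgn: "(- 1) ^ r \<in> p_integers p" by (intro p_integers_power p_integers_uminus) simp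
  \<comment> \<open>The sign is its own inverse; this clears it from the left side of the shift
    congruence at the end.\<close>
  have sq: "(- 1) ^ r * ((- 1) ^ r * y) = y" for y :: rat
    by (simp add: mult.assoc[symmetric] power_add[symmetric])
  have "p_cong p 1 (- of_nat r) (- ?x)"
    by (rule p_congI[OF _ t]) simp
  then have 1: "p_cong p 1 (?e (- of_nat r)) (?e (- ?x))"
    using t by (intro euler_polynomial_cong p_integers_intros) auto
  have "p_cong p 1 (?e 0 - 2 * alt_harm r) (?T - 2 * alt_harm r)"
    by (intro p_cong_diff euler_polynomial_0_cong p_cong_refl)
  with euler_polynomial_shift_cong[OF r]
  have "p_cong p 1 ((- 1) ^ r * ?e (- of_nat r)) (?T - 2 * alt_harm r)"
    by (rule p_cong_trans)
  from p_cong_trans[OF p_cong_sym[OF this] p_cong_cmult[OF 1 sgn]]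
  have "p_cong p 1 (?T - 2 * alt_harm r) ((- 1) ^ r * ?e (- ?x))" .
  from p_cong_cmult[OF this t]
  have "p_cong p 2 (?P * (t * (?T - 2 * alt_harm r))) (?P * (t * ((- 1) ^ r * ?e (- ?x))))"
    by (simp only: p_cong_2_iff)
  from p_cong_diff[OF p_cong_refl this, of 1]
  have 2: "p_cong p 2 (1 - ?P * (t * ?T) + ?P * (2 * t * alt_harm r))
      (1 - ?P * (t * ((- 1) ^ r * ?e (- ?x))))"
    by (simp add: algebra_simps)
  have "p_cong p 2 ((- 1) ^ r * ?S ?x) (1 - ?P * (t * ?T) + ?P * (2 * t * alt_harm r))"
    by (rule p_cong_trans[OF binom_sum_shift_cong[OF t r]
        p_cong_add[OF binom_sum_p_mult_cong[OF t] p_cong_refl]])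
  note p_cong_cmult[OF p_cong_trans[OF this 2] sgn]
  moreover have "s * (1 - x * (y * (s * z))) = s - s * (s * (x * (y * z)))" for s x y z :: rat
    by (simp add: algebra_simps)
  ultimately show ?thesis by (simp only: sq)
qed

end

end

theorem theorem7p1:
  fixes p :: nat and a :: rat
  assumes "prime p" and "p > 3"
    and "a \<in> p_integers p" and "\<not> p_cong p 1 a 0"
  shows "p_cong p 2
    (\<Sum>k = 0..p - 1. (a gchoose k) * (-2) ^ k)
    ((-1) ^ p_residue p a - (a - of_nat (p_residue p a)) * euler_polynomial (p - 2) (- a))"
proof -
  let ?r = "p_residue p a"
  have "?r \<in> {0..p - 1} \<and> p_cong p 1 a (of_nat ?r)"
    unfolding p_residue_def by (rule theI'[OF p_residue_unique[OF assms(1,3)]])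
  \<comment> \<open>The residue congruence makes \<open>t = (a - ?r) / p\<close> p-integral.\<close>
  then obtain t where t: "t \<in> p_integers p" "a = of_nat p * t + of_nat ?r" and r: "?r < p"
    using assms(2) by (auto simp: p_cong_iff[OF assms(1)])
  then have "a - of_nat ?r = of_nat p * t" by simp
  moreover have "odd p" using assms(1,2) by (intro prime_odd_nat) auto
  ultimately show ?thesis
    using binom_sum_cong_euler_polynomial[OF assms(1) _ t(1) r, folded t(2)]
    by (simp add: binom_sum_def mult.assoc)
qed

end
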